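(* Let $k\ge 2$. In the game described in the context (starting from the empty board), Builder has a strategy such that, against every strategy of Painter, at least one of the following occurs: a red $P_3$ or a blue $P_3$ appears within the first $6k-2$ rounds; or after at most $6k-3$ rounds the board contains a bad green $P_{4k-1}$; or after at most $6k-2$ rounds the board contains a good green $P_{4k-1}$.
   Context: $P_m$ denotes the path on $m$ vertices. Game: Builder and Painter play on an infinite vertex set, initially with no edges; in each round Builder draws an edge between two nonadjacent vertices and Painter immediately colors it red, blue or green. A green path is a path all of whose edges are green. A green path is called good if at least one of its endpoints is incident to a red or blue edge, and bad otherwise. *)

theory Defs
  imports Main
begin

datatype colour = Red | Blue | Green

text \<open>
  A history lists the coloured edges in the order in which they were drawn; an edge is the
  set of its two endpoints. The board is the set of entries of the history.
\<close>

type_synonym 'v history = "('v set \<times> colour) list"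

definition legal_move :: "'v set \<Rightarrow> 'v history \<Rightarrow> 'v set \<Rightarrow> bool" where
  "legal_move V h e \<longleftrightarrow>
     (\<exists>u\<in>V. \<exists>v\<in>V. u \<noteq> v \<and> e = {u, v}) \<and> e \<notin> fst ` set h"

inductive legal_history :: "'v set \<Rightarrow> 'v history \<Rightarrow> bool" for V where
  empty: "legal_history V []"
| round: "legal_history V h \<Longrightarrow> legal_move V h e \<Longrightarrow> legal_history V (h @ [(e, c)])"

type_synonym 'v builder = "'v history \<Rightarrow> 'v set"

text \<open>
  Painter sees the history and the edge just drawn. Every such function is a strategy,
  whereas a Builder strategy has to produce legal moves.
\<close>

type_synonym 'v painter = "'v history \<Rightarrow> 'v set \<Rightarrow> colour"

definition builder_strategy :: "'v set \<Rightarrow> 'v builder \<Rightarrow> bool" where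
  "builder_strategy V B \<longleftrightarrow> (\<forall>h. legal_history V h \<longrightarrow> legal_move V h (B h))"

primrec play :: "'v builder \<Rightarrow> 'v painter \<Rightarrow> nat \<Rightarrow> 'v history" where
  "play B P 0 = []"
| "play B P (Suc n) =
     (let h = play B P n; e = B h in h @ [(e, P h e)])"

definition mono_path :: "colour \<Rightarrow> 'v history \<Rightarrow> 'v list \<Rightarrow> bool" where
  "mono_path c h xs \<longleftrightarrow>
     xs \<noteq> [] \<and> distinct xs \<and> successively (\<lambda>u v. ({u, v}, c) \<in> set h) xs"

definition contains_mono_path :: "colour \<Rightarrow> nat \<Rightarrow> 'v history \<Rightarrow> bool" where
  "contains_mono_path c m h \<longleftrightarrow> (\<exists>xs. mono_path c h xs \<and> length xs = m)"

definition touches_red_or_blue :: "'v history \<Rightarrow> 'v \<Rightarrow> bool" where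
  "touches_red_or_blue h v \<longleftrightarrow> (\<exists>e c. (e, c) \<in> set h \<and> v \<in> e \<and> (c = Red \<or> c = Blue))"

definition good_green_path :: "'v history \<Rightarrow> 'v list \<Rightarrow> bool" where
  "good_green_path h xs \<longleftrightarrow>
     mono_path Green h xs \<and> (touches_red_or_blue h (hd xs) \<or> touches_red_or_blue h (last xs))"

definition bad_green_path :: "'v history \<Rightarrow> 'v list \<Rightarrow> bool" where
  "bad_green_path h xs \<longleftrightarrow> mono_path Green h xs \<and> \<not> good_green_path h xs"

definition contains_good_green_path :: "nat \<Rightarrow> 'v history \<Rightarrow> bool" where
  "contains_good_green_path m h \<longleftrightarrow> (\<exists>xs. good_green_path h xs \<and> length xs = m)"

definition contains_bad_green_path :: "nat \<Rightarrow> 'v history \<Rightarrow> bool" where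
  "contains_bad_green_path m h \<longleftrightarrow> (\<exists>xs. bad_green_path h xs \<and> length xs = m)"

end

theory Submission
  imports Defs
begin

text \<open>
  Red and blue are matchings as long as Painter avoids a monochromatic \<open>P\<^sub>3\<close>, so a vertex that is
  already incident to a red edge leaves Painter only blue and green. Call a board with a green
  \<open>P\<^bsub>4k-1\<^esub>\<close> after \<open>6k-3\<close> rounds, or with a good one after \<open>6k-2\<close> rounds, a position of level \<open>k\<close>.
  From level \<open>k \<ge> 1\<close> Builder reaches level \<open>k+1\<close> by an explicit finite strategy that only touches
  the two endpoints of the long green path and fresh vertices, and therefore does not depend on
  \<open>k\<close>. From the empty board an explicit finite strategy reaches level 1 or directly level 2.
  The finite strategies are decision trees over the natural
  numbers, whose correctness is a computation.
\<close>

section \<open>Positions from which Builder can force a target\<close>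

text \<open>A least fixed point: whatever Painter answers, \<open>W\<close> is reached after
  finitely many rounds.\<close>

inductive forces :: "'v set \<Rightarrow> ('v history \<Rightarrow> bool) \<Rightarrow> 'v history \<Rightarrow> bool"
  for V :: "'v set" and W :: "'v history \<Rightarrow> bool" where
  reached: "W h \<Longrightarrow> forces V W h"
| move: "legal_move V h e \<Longrightarrow> (\<And>c. forces V W (h @ [(e, c)])) \<Longrightarrow> forces V W h"

text \<open>Strategies are chained by grafting one for \<open>W'\<close> onto every position where
  \<open>W\<close> is reached; legality is carried along because the second strategy is given for
  legal positions only.\<close>

lemma forces_trans:
  assumes "forces V W h" "legal_history V h"
    and "\<And>h. legal_history V h \<Longrightarrow> W h \<Longrightarrow> forces V W' h"
  shows "forces V W' h"
  using assms(1,2)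
proof (induction rule: forces.induct)
  case (reached h)
  then show ?case by (simp add: assms(3))
next
  case (move h e)
  then show ?case by (meson forces.move legal_history.round)
qed

lemma legal_history_edge:
  assumes "legal_history V h" "(e, c) \<in> set h"
  obtains u v where "u \<in> V" "v \<in> V" "u \<noteq> v" "e = {u, v}"
  using assms by (induction rule: legal_history.induct) (auto simp: legal_move_def)

definition vertices :: "'v history \<Rightarrow> 'v set" where
  "vertices h = \<Union> (fst ` set h)"

lemma finite_vertices: "legal_history V h \<Longrightarrow> finite (vertices h)"
  unfolding vertices_def by (induction rule: legal_history.induct) (auto simp: legal_move_def)

lemma legal_move_exists:
  assumes "infinite V" "legal_history V h"
  shows "\<exists>e. legal_move V h e"
proof -
  have inf: "infinite (V - vertices h)"
    using assms finite_vertices Diff_infinite_finite by blast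
  obtain u v where "u \<noteq> v" "{u, v} \<subseteq> V - vertices h"
    using infinite_arbitrarily_large[OF inf, of 2] by (metis card_2_iff)
  then have "legal_move V h {u, v}"
    by (fastforce simp: legal_move_def vertices_def)
  then show ?thesis ..
qed

lemma length_play [simp]: "length (play B P n) = n"
  by (induction n) (simp_all add: Let_def)

lemma legal_history_play: "builder_strategy V B \<Longrightarrow> legal_history V (play B P n)"
  by (induction n) (auto simp: Let_def builder_strategy_def intro: legal_history.intros)

text \<open>
  The bound on the length of target positions makes the strategy that merely stays inside the
  forcing positions reach the target: it cannot stay there for ever.
\<close>

lemma forces_imp_strategy:
  assumes V: "infinite V" and f: "forces V W []" and bound: "\<And>h. W h \<Longrightarrow> length h \<le> N"
  shows "\<exists>B. builder_strategy V B \<and> (\<forall>P. \<exists>n. W (play B P n))"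
proof -
  \<comment> \<open>A forcing position is a target or has a longer forcing successor, so it inherits
    the bound on targets.\<close>
  have bound': "length h \<le> N" if "forces V W h" for h
    using that by (induction rule: forces.induct) (use bound in fastforce)+
  define good where "good h e \<longleftrightarrow> legal_move V h e \<and> (\<forall>c. forces V W (h @ [(e, c)]))" for h e
  define B where "B h = (if \<exists>e. good h e then SOME e. good h e else SOME e. legal_move V h e)" for h
  have good_B: "good h (B h)" if "\<exists>e. good h e" for h
    using someI_ex[OF that] that by (simp add: B_def)
  have B: "builder_strategy V B"
    unfolding builder_strategy_def
  proof (intro allI impI)
    fix h assume h: "legal_history V h"
    show "legal_move V h (B h)"
    proof (cases "\<exists>e. good h e")
      case True
      then show ?thesis using good_B good_def by blast
    next
      case False
      then show ?thesis
        using someI_ex[OF legal_move_exists[OF V h]] by (simp add: B_def)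
    qed
  qed
  moreover have "\<exists>n. W (play B P n)" for P
  proof (rule ccontr)
    assume no: "\<not> (\<exists>n. W (play B P n))"
    have "forces V W (play B P n)" for n
    proof (induction n)
      case 0
      then show ?case using f by simp
    next
      case (Suc n)
      then have "\<exists>e. good (play B P n) e"
        using no by (cases rule: forces.cases) (auto simp: good_def)
      then show ?case
        using good_B by (simp add: Let_def good_def)
    qed
    then show False
      using bound' by (metis length_play not_less_eq_eq order_refl)
  qed
  ultimately show ?thesis by blast
qed

section \<open>Finite strategies as decision trees\<close>

text \<open>
  The green path present at the start stays abstract; its first and last vertex are the numbers
  \<open>a\<close> and \<open>b\<close>, and all other numbers are fresh vertices. \<open>Stop xs ys\<close> claims the green path
  obtained by prolonging the initial one with \<open>xs\<close> before \<open>a\<close> and \<open>ys\<close> behind \<open>b\<close>, and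
  \<open>Draw i j r l g\<close> continues with \<open>r\<close>, \<open>l\<close> or \<open>g\<close> if Painter answers red, blue or green.
  A subtree \<open>Stop [] []\<close> below is a dummy for an answer that would complete a red or blue \<open>P\<^sub>3\<close>.
\<close>

datatype tree = Stop "nat list" "nat list" | Draw nat nat tree tree tree

abbreviation forced :: "nat \<Rightarrow> nat \<Rightarrow> tree \<Rightarrow> tree" where
  "forced i j \<equiv> Draw i j (Stop [] []) (Stop [] [])"

abbreviation red_or :: "nat \<Rightarrow> nat \<Rightarrow> tree \<Rightarrow> tree \<Rightarrow> tree" where
  "red_or i j r \<equiv> Draw i j r (Stop [] [])"

abbreviation blue_or :: "nat \<Rightarrow> nat \<Rightarrow> tree \<Rightarrow> tree \<Rightarrow> tree" where
  "blue_or i j \<equiv> Draw i j (Stop [] [])"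

primrec swap :: "tree \<Rightarrow> tree" where
  "swap (Stop xs ys) = Stop xs ys"
| "swap (Draw i j r l g) = Draw i j (swap l) (swap r) (swap g)"

text \<open>This only saves writing out a mirrored blue branch. No symmetry argument is involved,
  since \<open>wins\<close> checks red and blue separately.\<close>

abbreviation symmetric :: "nat \<Rightarrow> nat \<Rightarrow> tree \<Rightarrow> tree \<Rightarrow> tree" where
  "symmetric i j r \<equiv> Draw i j r (swap r)"

type_synonym board = "(nat \<times> nat \<times> colour) list"

definition edge :: "board \<Rightarrow> colour \<Rightarrow> nat \<Rightarrow> nat \<Rightarrow> bool" where
  "edge p c i j \<longleftrightarrow> (i, j, c) \<in> set p \<or> (j, i, c) \<in> set p"

text \<open>The argument \<open>t\<close> is the colour, if any, of a red or blue edge that was initially at \<open>a\<close>.\<close>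

definition touched :: "colour option \<Rightarrow> nat \<Rightarrow> board \<Rightarrow> colour \<Rightarrow> nat \<Rightarrow> bool" where
  "touched t a p c i \<longleftrightarrow> i = a \<and> t = Some c \<or> list_ex (\<lambda>(x, y, d). d = c \<and> (x = i \<or> y = i)) p"

text \<open>
  A pair \<open>(n, L)\<close> in \<open>goals\<close> allows the green path to be prolonged by \<open>n\<close> vertices within \<open>L\<close>
  rounds, or within \<open>L + 1\<close> rounds if the result is good.
\<close>

primrec wins ::
  "nat \<Rightarrow> (nat \<times> nat) list \<Rightarrow> colour option \<Rightarrow> nat \<Rightarrow> nat \<Rightarrow> board \<Rightarrow> tree \<Rightarrow> bool" where
  "wins N goals t a b p (Stop xs ys) \<longleftrightarrow>
     distinct (xs @ ys) \<and> a \<notin> set (xs @ ys) \<and> b \<notin> set (xs @ ys) \<and>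
     successively (edge p Green) (xs @ [a]) \<and> successively (edge p Green) (b # ys) \<and>
     list_ex (\<lambda>(n, L). length xs + length ys = n \<and>
       (length p \<le> L \<or> length p \<le> Suc L \<and>
         list_ex (\<lambda>c. touched t a p c (hd (xs @ [a])) \<or> touched t a p c (last (b # ys))) [Red, Blue]))
       goals"
| "wins N goals t a b p (Draw i j r l g) \<longleftrightarrow>
     length p < N \<and> i \<noteq> j \<and> \<not> (i = a \<and> j = b) \<and> \<not> (i = b \<and> j = a) \<and>
     list_all (\<lambda>c. \<not> edge p c i j) [Red, Blue, Green] \<and>
     (touched t a p Red i \<or> touched t a p Red j \<or> wins N goals t a b (p @ [(i, j, Red)]) r) \<and>
     (touched t a p Blue i \<or> touched t a p Blue j \<or> wins N goals t a b (p @ [(i, j, Blue)]) l) \<and>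
     wins N goals t a b (p @ [(i, j, Green)]) g"

definition embed :: "(nat \<Rightarrow> 'v) \<Rightarrow> board \<Rightarrow> 'v history" where
  "embed f p = map (\<lambda>(i, j, c). ({f i, f j}, c)) p"

lemma length_embed [simp]: "length (embed f p) = length p"
  by (simp add: embed_def)

lemma embed_snoc: "embed f (p @ [(i, j, c)]) = embed f p @ [({f i, f j}, c)]"
  by (simp add: embed_def)

lemma edge_embed: "edge p c i j \<Longrightarrow> ({f i, f j}, c) \<in> set (embed f p)"
  by (force simp: edge_def embed_def insert_commute)

lemma edge_if_embed:
  assumes "inj f" "({f i, f j}, c) \<in> set (embed f p)"
  shows "edge p c i j"
  using assms by (auto simp: edge_def embed_def doubleton_eq_iff inj_eq)

lemma touched_embed:
  assumes "touched t a p c i" and t: "t = Some c \<Longrightarrow> \<exists>e. (e, c) \<in> set h \<and> f a \<in> e"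
  shows "\<exists>e. (e, c) \<in> set (h @ embed f p) \<and> f i \<in> e"
proof -
  consider "i = a" "t = Some c" | x y where "(x, y, c) \<in> set p" "i = x \<or> i = y"
    using assms(1) by (auto simp: touched_def list_ex_iff)
  then show ?thesis
  proof cases
    case 1
    then show ?thesis using t by auto
  next
    case 2
    then have "({f x, f y}, c) \<in> set (embed f p)" by (force simp: embed_def)
    with 2(2) show ?thesis by auto
  qed
qed

lemma contains_mono_path_3:
  assumes "({y, x}, c) \<in> set h" "({x, z}, c) \<in> set h" "x \<noteq> y" "x \<noteq> z" "y \<noteq> z"
  shows "contains_mono_path c 3 h"
  unfolding contains_mono_path_def mono_path_def
  by (rule exI[of _ "[y, x, z]"]) (use assms in auto)

text \<open>Soundness of the computed check, by induction on the tree while the board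
  \<open>p\<close> grows. An answer that repeats red or blue at a vertex completes a path on three
  vertices; as \<open>length p < N\<close> before each move, this happens within \<open>N\<close>
  rounds.\<close>

lemma wins_imp_forces:
  fixes f :: "nat \<Rightarrow> 'v"
  assumes f: "inj f" "range f \<subseteq> V"
    and fresh: "\<And>i. f i \<in> vertices h0 \<union> set Q \<Longrightarrow> i = a \<or> i = b"
    and Q: "mono_path Green h0 Q" "hd Q = f a" "last Q = f b"
    and t: "\<And>c. t = Some c \<Longrightarrow> \<exists>e. (e, c) \<in> set h0 \<and> f a \<in> e"
    and P3: "\<And>h c. c \<noteq> Green \<Longrightarrow> contains_mono_path c 3 h \<Longrightarrow> length h \<le> length h0 + N \<Longrightarrow> W h"
    and long: "\<And>h xs n L. mono_path Green h xs \<Longrightarrow> (n, L) \<in> set goals \<Longrightarrow>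
      length xs = length Q + n \<Longrightarrow>
      length h \<le> length h0 + L \<or>
      length h \<le> length h0 + Suc L \<and>
        (touches_red_or_blue h (hd xs) \<or> touches_red_or_blue h (last xs)) \<Longrightarrow> W h"
    and legal: "legal_history V (h0 @ embed f p)"
    and wins: "wins N goals t a b p s"
  shows "forces V W (h0 @ embed f p)"
  using wins legal
proof (induction s arbitrary: p)
  case (Stop xs ys)
  let ?h = "h0 @ embed f p"
  let ?ps = "map f xs @ Q @ map f ys"
  from Q(1) have Q': "Q \<noteq> []" "distinct Q" "successively (\<lambda>u v. ({u, v}, Green) \<in> set h0) Q"
    by (auto simp: mono_path_def)
  from Stop.prems(1) obtain n L where nL: "(n, L) \<in> set goals" "length xs + length ys = n"
    and rounds: "length p \<le> L \<or> length p \<le> Suc L \<and>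
      (\<exists>c\<in>{Red, Blue}. touched t a p c (hd (xs @ [a])) \<or> touched t a p c (last (b # ys)))"
    by (auto simp: list_ex_iff)
  have disj: "f i \<notin> set Q" if "i \<in> set (xs @ ys)" for i
    using that fresh[of i] Stop.prems(1) by auto
  have succ_f: "successively (\<lambda>u v. ({u, v}, Green) \<in> set ?h) (map f zs)"
    if "successively (edge p Green) zs" for zs
    using that unfolding successively_map by (rule successively_mono) (auto dest: edge_embed)
  \<comment> \<open>Including \<open>a\<close> and \<open>b\<close> in the prolongations supplies
    the edges that join them to \<open>Q\<close>.\<close>
  have left: "successively (\<lambda>u v. ({u, v}, Green) \<in> set ?h) (map f xs @ [f a])"
    using succ_f[of "xs @ [a]"] Stop.prems(1) by simp
  have right: "successively (\<lambda>u v. ({u, v}, Green) \<in> set ?h) (f b # map f ys)"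
    using succ_f[of "b # ys"] Stop.prems(1) by simp
  have mid: "successively (\<lambda>u v. ({u, v}, Green) \<in> set ?h) Q"
    using Q'(3) by (rule successively_mono) auto
  have path: "mono_path Green ?h ?ps"
    unfolding mono_path_def
  proof (intro conjI)
    show "?ps \<noteq> []" using Q' by simp
    show "distinct ?ps"
      using Stop.prems(1) Q'(2) disj f(1)
      by (auto simp: distinct_map inj_eq intro: inj_on_subset)
    show "successively (\<lambda>u v. ({u, v}, Green) \<in> set ?h) ?ps"
      using left right mid Q' Q(2,3)
      by (auto simp: successively_append_iff successively_Cons)
  qed
  have touch: "touches_red_or_blue ?h (f i)" if "touched t a p c i" "c \<in> {Red, Blue}" for c i
    using touched_embed[where f = f, OF that(1) t] that(2) unfolding touches_red_or_blue_def by blast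
  have ends: "hd ?ps = f (hd (xs @ [a]))" "last ?ps = f (last (b # ys))"
    using Q' Q(2,3) by (auto simp: hd_append last_map hd_map)
  have "W ?h"
  proof (rule long[OF path nL(1)])
    show "length ?ps = length Q + n" using nL(2) by simp
    show "length ?h \<le> length h0 + L \<or> length ?h \<le> length h0 + Suc L \<and>
        (touches_red_or_blue ?h (hd ?ps) \<or> touches_red_or_blue ?h (last ?ps))"
      using rounds touch unfolding ends by auto
  qed
  then show ?case by (rule forces.reached)
next
  case (Draw i j r l g)
  let ?h = "h0 @ embed f p"
  let ?e = "{f i, f j}"
  \<comment> \<open>By \<open>fresh\<close>, only \<open>a\<close> and \<open>b\<close> can lie on
    the old board, and \<open>wins\<close> forbids the edge between them.\<close>
  have new: "?e \<notin> fst ` set ?h"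
  proof
    assume "?e \<in> fst ` set ?h"
    then consider "?e \<in> fst ` set h0" | c where "(?e, c) \<in> set (embed f p)" by auto
    then show False
    proof cases
      case 1
      then have "f i \<in> vertices h0" "f j \<in> vertices h0" by (auto simp: vertices_def)
      then show False using fresh[of i] fresh[of j] Draw.prems(1) by auto
    next
      case 2
      then show False
        using edge_if_embed[OF f(1)] Draw.prems(1) by (cases c) auto
    qed
  qed
  have ij: "f i \<noteq> f j" using f(1) Draw.prems(1) by (simp add: inj_eq)
  have legal: "legal_move V ?h ?e"
    unfolding legal_move_def using new ij f(2) by blast
  have round: "legal_history V (h0 @ embed f (p @ [(i, j, c)]))" for c
    using legal_history.round[OF Draw.prems(2) legal] by (simp add: embed_snoc)
  have P3': "forces V W (?h @ [(?e, c)])"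
    if c: "c \<noteq> Green" and "touched t a p c i \<or> touched t a p c j" for c
  proof -
    have "\<exists>e. (e, c) \<in> set ?h \<and> f k \<in> e" if "touched t a p c k" for k
      by (rule touched_embed[where f = f, OF that t])
    then obtain x y where xy: "{x, y} = ?e" "x \<noteq> y" and "\<exists>e. (e, c) \<in> set ?h \<and> x \<in> e"
      using \<open>touched t a p c i \<or> touched t a p c j\<close> ij by (metis insert_commute)
    then obtain e where e: "(e, c) \<in> set ?h" "x \<in> e" by blast
    obtain u v where "u \<noteq> v" "e = {u, v}"
      using legal_history_edge[OF Draw.prems(2) e(1)] by metis
    then obtain z where z: "e = {z, x}" "z \<noteq> x" using e(2) by auto
    \<comment> \<open>If \<open>z = y\<close>, the old edge \<open>e\<close> would be the new edge,
      drawn twice.\<close>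
    have "z \<noteq> y" using new e(1) z xy by (metis fst_conv image_eqI insert_commute)
    then have "contains_mono_path c 3 (?h @ [(?e, c)])"
      using e(1) z xy by (intro contains_mono_path_3[of z x c _ y]) auto
    then show ?thesis
      using P3[OF c] Draw.prems(1) by (intro forces.reached) auto
  qed
  have "forces V W (?h @ [(?e, c)])" for c
  proof (cases c)
    case Red
    then show ?thesis
      using P3'[of Red] Draw.IH(1)[OF _ round] Draw.prems(1) by (auto simp: embed_snoc)
  next
    case Blue
    then show ?thesis
      using P3'[of Blue] Draw.IH(2)[OF _ round] Draw.prems(1) by (auto simp: embed_snoc)
  next
    case Green
    then show ?thesis
      using Draw.IH(3)[OF _ round] Draw.prems(1) by (auto simp: embed_snoc)
  qed
  then show ?case using legal by (rule forces.move[rotated])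
qed

section \<open>The explicit strategies\<close>

text \<open>The three trees were found by computer search. The opening starts from the green
  path with the single vertex 0, hence \<open>a = b = 0\<close>.\<close>

definition extend_tree :: tree where
  "extend_tree =
    symmetric 2 3
     (blue_or 0 2
       (forced 0 3 (forced 2 4 (forced 2 5 (
           blue_or 3 4 (forced 3 5 (Stop [4, 2, 5, 3] [])) (Stop [5, 2, 4, 3] [])))))
       (blue_or 3 4
         (forced 1 3 (forced 2 4 (forced 3 5 (Stop [4, 2] [3, 5]))))
         (blue_or 2 5
           (forced 2 4 (forced 3 5 (Stop [5, 3, 4, 2] [])))
           (blue_or 1 3 (forced 3 5 (Stop [4, 3, 5, 2] [])) (Stop [5, 2] [3, 4])))))
     (symmetric 0 4
       (blue_or 2 4
         (forced 0 2 (forced 1 4 (forced 4 5 (Stop [3, 2] [4, 5]))))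
         (blue_or 0 5
           (forced 0 3 (forced 4 5 (Stop [5, 4, 2, 3] [])))
           (blue_or 1 4 (forced 4 5 (Stop [3, 2, 4, 5] [])) (Stop [5] [4, 2, 3]))))
       (symmetric 1 2
         (blue_or 1 5
           (forced 1 3 (forced 2 5 (Stop [4] [3, 2, 5])))
           (blue_or 2 4 (forced 2 5 (Stop [4] [5, 2, 3])) (Stop [3, 2, 4] [5])))
         (symmetric 3 5
           (blue_or 3 6 (forced 3 7 (Stop [4] [2, 3, 7])) (Stop [4] [2, 3, 6]))
           (Stop [4] [2, 3, 5]))))"

definition extend_good_tree :: tree where
  "extend_good_tree =
    Draw 2 3
     (blue_or 2 4
       (forced 1 2 (forced 0 4 (forced 3 4 (forced 2 5 (Stop [3, 4] [2, 5])))))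
       (blue_or 0 3
         (forced 1 3 (forced 0 4 (forced 3 5 (Stop [2, 4] [3, 5]))))
         (blue_or 2 5
           (forced 1 2 (forced 3 5 (Stop [5, 3] [2, 4])))
           (blue_or 3 4 (forced 3 5 (Stop [4, 2, 5, 3] [])) (Stop [5, 2, 4, 3] [])))))
     (forced 0 2 (
       red_or 3 4
        (forced 1 3 (forced 2 4 (forced 3 5 (Stop [4, 2] [3, 5]))))
        (red_or 2 5
          (forced 2 4 (forced 3 5 (Stop [5, 3, 4, 2] [])))
          (red_or 1 3 (forced 3 5 (Stop [4, 3, 5, 2] [])) (Stop [5, 2] [3, 4])))))
     (blue_or 0 4
       (forced 0 5 (
         red_or 1 4
          (forced 2 4 (forced 4 5 (Stop [3, 2, 4, 5] [])))
          (red_or 2 4 (forced 3 4 (Stop [5] [4, 3, 2])) (Stop [5] [4, 2, 3]))))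
       (symmetric 1 2
         (blue_or 1 5
           (forced 1 3 (forced 2 5 (Stop [4] [3, 2, 5])))
           (blue_or 2 4 (forced 2 5 (Stop [4] [5, 2, 3])) (Stop [3, 2, 4] [5])))
         (symmetric 5 6
           (blue_or 3 5 (forced 4 5 (Stop [5, 4] [2, 3])) (Stop [4] [2, 3, 5]))
           (blue_or 0 5 (forced 0 6 (Stop [5, 6] [2, 3])) (Stop [6, 5] [2, 3])))))"

definition opening_tree :: tree where
  "opening_tree =
    symmetric 0 1
     (blue_or 0 2
       (forced 0 3 (
         blue_or 1 3
          (forced 1 2 (forced 0 4 (forced 1 5 (
              red_or 2 6
               (forced 2 4 (forced 3 6 (Stop [6, 3] [4, 2, 1, 5])))
               (red_or 3 5
                 (forced 3 6 (Stop [5, 1, 2, 6, 3] [4]))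
                 (Stop [4] [3, 5, 1, 2, 6]))))))
          (Stop [] [3, 1])))
       (blue_or 1 2
         (blue_or 0 3
           (forced 1 3 (forced 0 4 (forced 1 5 (
               red_or 2 6
                (forced 2 5 (forced 3 6 (Stop [6, 3, 1, 5, 2] [4])))
                (red_or 3 4
                  (forced 3 6 (Stop [4] [2, 6, 3, 1, 5]))
                  (Stop [5, 1, 3, 4] [2, 6]))))))
           (Stop [2] [3]))
         (Stop [] [2, 1])))
     (symmetric 0 2
       (blue_or 1 2
         (blue_or 0 3
           (forced 2 3 (forced 0 4 (forced 2 5 (
               red_or 1 6
                (forced 1 5 (forced 3 6 (Stop [6, 3, 2, 5, 1] [4])))
                (red_or 3 4
                  (forced 3 6 (Stop [4] [1, 6, 3, 2, 5]))
                  (Stop [5, 2, 3, 4] [1, 6]))))))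
           (Stop [1] [3]))
         (Stop [] [1, 2]))
       (Stop [1] [2]))"

text \<open>Level \<open>k + 1\<close> allows \<open>6 * k + 3\<close> rounds: 6 more after
  \<open>6 * k - 3\<close>, but 5 more after \<open>6 * k - 2\<close>. The first argument of
  \<open>wins\<close> is one larger, as the extra round is open to a red or blue path on three
  vertices or a good green path.\<close>

lemma wins_extend_tree: "wins 7 [(4, 6)] None 0 1 [] extend_tree"
  by code_simp

lemma wins_extend_good_tree: "wins 6 [(4, 5)] (Some Red) 0 1 [] extend_good_tree"
  by code_simp

lemma wins_extend_good_tree_swap: "wins 6 [(4, 5)] (Some Blue) 0 1 [] (swap extend_good_tree)"
  by code_simp

text \<open>Adding 2 or 6 vertices to a single one gives the path lengths 3 and 7 of levels 1 and 2,
  with their 3 and 9 rounds; 10 is \<open>6 * 2 - 2\<close>.\<close>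

lemma wins_opening_tree: "wins 10 [(2, 3), (6, 9)] None 0 0 [] opening_tree"
  by code_simp

section \<open>Climbing the levels\<close>

text \<open>The red and blue paths are included so that a losing answer by Painter counts for every
  later level too.\<close>

definition level :: "nat \<Rightarrow> 'v history \<Rightarrow> bool" where
  "level k h \<longleftrightarrow>
     length h \<le> 6 * k - 2 \<and> (contains_mono_path Red 3 h \<or> contains_mono_path Blue 3 h) \<or>
     length h \<le> 6 * k - 3 \<and> contains_bad_green_path (4 * k - 1) h \<or>
     length h \<le> 6 * k - 2 \<and> contains_good_green_path (4 * k - 1) h"

lemma level_P3:
  "c \<noteq> Green \<Longrightarrow> contains_mono_path c 3 h \<Longrightarrow> length h \<le> 6 * k - 2 \<Longrightarrow> level k h"
  by (cases c) (auto simp: level_def)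

lemma level_green:
  assumes "mono_path Green h xs" "length xs = 4 * k - 1"
    and "length h \<le> 6 * k - 3 \<or> length h \<le> 6 * k - 2 \<and>
      (touches_red_or_blue h (hd xs) \<or> touches_red_or_blue h (last xs))"
  shows "level k h"
  using assms
  by (auto simp: level_def contains_good_green_path_def contains_bad_green_path_def
      bad_green_path_def good_green_path_def)

lemma mono_path_rev:
  assumes "mono_path c h xs"
  shows "mono_path c h (rev xs)"
  using assms by (auto simp: mono_path_def insert_commute)

lemma mono_path_in_vertices:
  assumes "mono_path c h xs" "length xs \<ge> 2"
  shows "hd xs \<in> vertices h" "last xs \<in> vertices h"
proof -
  have hd: "hd ys \<in> vertices h" if "mono_path c h ys" "length ys \<ge> 2" for ys
    using that
    \<comment> \<open>This case rule separates lists of length 0, 1 and at least 2.\<close>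
    by (cases ys rule: remdups_adj.cases) (force simp: mono_path_def vertices_def)+
  show "hd xs \<in> vertices h" using hd assms by blast
  show "last xs \<in> vertices h" using hd[OF mono_path_rev[OF assms(1)]] assms(2) by (simp add: hd_rev)
qed

text \<open>Having at least two vertices makes the ends of \<open>Q\<close> distinct, so that
  \<open>f\<close> can be injective, and puts them on drawn edges, hence in
  \<open>V\<close>.\<close>

lemma ends_and_fresh_vertices:
  assumes V: "infinite V" "legal_history V h"
    and Q: "mono_path c h Q" "length Q \<ge> 2"
  obtains f :: "nat \<Rightarrow> 'v" where "inj f" "range f \<subseteq> V" "f 0 = hd Q" "f 1 = last Q"
    "\<And>i. f i \<in> vertices h \<union> set Q \<Longrightarrow> i = 0 \<or> i = 1"
proof -
  have "infinite (V - (vertices h \<union> set Q))"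
    using V finite_vertices[OF V(2)] by simp
  then obtain g :: "nat \<Rightarrow> 'v" where g: "inj g" "range g \<subseteq> V - (vertices h \<union> set Q)"
    using infinite_countable_subset by blast
  define f where "f i = (if i = 0 then hd Q else if i = 1 then last Q else g i)" for i
  have vV: "vertices h \<subseteq> V"
    by (auto simp: vertices_def elim!: legal_history_edge[OF V(2)])
  have neq: "hd Q \<noteq> last Q"
    using Q by (cases Q) (auto simp: mono_path_def)
  have "g i \<notin> set Q" for i using g(2) by blast
  moreover have "hd Q \<in> set Q" "last Q \<in> set Q" using Q(1) by (auto simp: mono_path_def)
  ultimately have gQ: "g i \<noteq> hd Q" "g i \<noteq> last Q" for i by metis+
  show thesis
  proof
    show "inj f"
      using g(1) neq gQ gQ[symmetric] unfolding inj_def f_def by simp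
    show "range f \<subseteq> V"
      using g vV mono_path_in_vertices[OF Q] by (auto simp: f_def)
    show "f 0 = hd Q" "f 1 = last Q" by (auto simp: f_def)
    show "i = 0 \<or> i = 1" if "f i \<in> vertices h \<union> set Q" for i
      using that g(2) by (auto simp: f_def split: if_splits)
  qed
qed

lemma level_Suc:
  fixes h :: "'v history"
  assumes V: "infinite V" "legal_history V h" and k: "k \<ge> 1" and h: "level k h"
  shows "forces V (level (Suc k)) h"
proof -
  have win: "forces V (level (Suc k)) h"
    if Q: "mono_path Green h Q" "length Q = 4 * k - 1"
      and L: "length h + L \<le> 6 * k + 3" "N = Suc L"
      and t: "\<And>c. t = Some c \<Longrightarrow> \<exists>e. (e, c) \<in> set h \<and> hd Q \<in> e"
      and s: "wins N [(4, L)] t 0 1 [] s"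
    for Q L N t s
  proof -
    have "length Q \<ge> 2" using Q(2) k by simp
    then obtain f :: "nat \<Rightarrow> 'v" where f: "inj f" "range f \<subseteq> V" "hd Q = f 0" "last Q = f 1"
      and fresh: "\<And>i. f i \<in> vertices h \<union> set Q \<Longrightarrow> i = 0 \<or> i = 1"
      using ends_and_fresh_vertices[OF V Q(1)] by metis
    have "forces V (level (Suc k)) (h @ embed f [])"
    proof (rule wins_imp_forces[OF f(1,2) fresh Q(1) f(3,4) _ _ _ _ s])
      show "\<exists>e. (e, c) \<in> set h \<and> f 0 \<in> e" if "t = Some c" for c
        using t[OF that] f(3) by simp
      show "level (Suc k) h'"
        if "c \<noteq> Green" "contains_mono_path c 3 h'" "length h' \<le> length h + N" for h' c
        using that L by (intro level_P3) auto
      show "level (Suc k) h'"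
        if "mono_path Green h' xs" "(n, L') \<in> set [(4, L)]" "length xs = length Q + n"
          "length h' \<le> length h + L' \<or> length h' \<le> length h + Suc L' \<and>
             (touches_red_or_blue h' (hd xs) \<or> touches_red_or_blue h' (last xs))"
        for h' xs n L'
        using that L Q(2) k by (intro level_green[OF that(1)]) auto
      show "legal_history V (h @ embed f [])" using V(2) by (simp add: embed_def)
    qed
    then show ?thesis by (simp add: embed_def)
  qed
  \<comment> \<open>The tree expects the touched end at vertex 0; a path touched at its other end is
    reversed first. A blue edge there calls for the swapped tree.\<close>
  have good_end: "forces V (level (Suc k)) h"
    if Q: "mono_path Green h Q" "length Q = 4 * k - 1" "length h \<le> 6 * k - 2"
      "touches_red_or_blue h (hd Q)" for Q
  proof -
    obtain e c where ec: "(e, c) \<in> set h" "hd Q \<in> e" "c = Red \<or> c = Blue"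
      using Q(4) by (auto simp: touches_red_or_blue_def)
    have "\<exists>s. wins 6 [(4, 5)] (Some c) 0 1 [] s"
      using ec(3) wins_extend_good_tree wins_extend_good_tree_swap by blast
    then obtain s where "wins 6 [(4, 5)] (Some c) 0 1 [] s" ..
    then show ?thesis
      using Q ec k by (intro win[of Q 5 6 "Some c" s]) auto
  qed
  from h consider
      (P3) "level (Suc k) h"
    | (bad) Q where "mono_path Green h Q" "length Q = 4 * k - 1" "length h \<le> 6 * k - 3"
    | (good) Q where "mono_path Green h Q" "length Q = 4 * k - 1" "length h \<le> 6 * k - 2"
        "touches_red_or_blue h (hd Q) \<or> touches_red_or_blue h (last Q)"
    unfolding level_def contains_bad_green_path_def contains_good_green_path_def
      bad_green_path_def good_green_path_def by fastforce
  then show ?thesis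
  proof cases
    case P3
    then show ?thesis by (rule forces.reached)
  next
    case bad
    then show ?thesis
      using k by (intro win[OF _ _ _ _ _ wins_extend_tree]) auto
  next
    case (good Q)
    then show ?thesis
      using good_end[of Q] good_end[of "rev Q"] mono_path_rev by (auto simp: hd_rev)
  qed
qed

lemma level_1_or_2:
  fixes V :: "'v set"
  assumes "infinite V"
  shows "forces V (\<lambda>h. level 1 h \<or> level 2 h) []"
proof -
  obtain f :: "nat \<Rightarrow> 'v" where f: "inj f" "range f \<subseteq> V"
    using infinite_countable_subset[OF assms] by blast
  have "forces V (\<lambda>h. level 1 h \<or> level 2 h) ([] @ embed f [])"
  proof (rule wins_imp_forces[OF f _ _ _ _ _ _ _ _ wins_opening_tree, where Q = "[f 0]"])
    show "i = 0 \<or> i = 0" if "f i \<in> vertices [] \<union> set [f 0]" for i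
      using that f(1) by (auto simp: vertices_def inj_eq)
    show "level 1 h \<or> level 2 h"
      if "c \<noteq> Green" "contains_mono_path c 3 h" "length h \<le> length [] + 10" for h :: "'v history" and c
      using that by (auto intro: level_P3)
    show "level 1 h \<or> level 2 h"
      if "mono_path Green h xs" "(n, L) \<in> set [(2, 3), (6, 9)]" "length xs = length [f 0] + n"
        "length h \<le> length [] + L \<or> length h \<le> length [] + Suc L \<and>
           (touches_red_or_blue h (hd xs) \<or> touches_red_or_blue h (last xs))"
      for h :: "'v history" and xs n L
      using that level_green[OF that(1), of 1] level_green[OF that(1), of 2] by auto
  qed (auto simp: mono_path_def embed_def legal_history.empty)
  then show ?thesis by (simp add: embed_def)
qed

lemma forces_level:
  assumes "infinite V" "k \<ge> 2"
  shows "forces V (level k) []"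
  using assms(2)
proof (induction k rule: dec_induct)
  case base
  show ?case
    \<comment> \<open>Branches of the opening that stop at level 1 climb once; those at level 2 are
      finished.\<close>
    using level_Suc[OF assms(1), of _ 1]
    by (intro forces_trans[OF level_1_or_2[OF assms(1)] legal_history.empty])
      (auto simp: numeral_2_eq_2 intro: forces.reached)
next
  case (step k)
  then show ?case
    using level_Suc[OF assms(1), of _ k]
    by (intro forces_trans[OF step.IH legal_history.empty]) auto
qed

theorem theorem3p9:
  fixes V :: "'v set" and k :: nat
  assumes "infinite V" and "k \<ge> 2"
  shows "\<exists>B. builder_strategy V B \<and>
    (\<forall>P. (\<exists>n \<le> 6 * k - 2. contains_mono_path Red 3 (play B P n)
                          \<or> contains_mono_path Blue 3 (play B P n))
       \<or> (\<exists>n \<le> 6 * k - 3. contains_bad_green_path (4 * k - 1) (play B P n))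
       \<or> (\<exists>n \<le> 6 * k - 2. contains_good_green_path (4 * k - 1) (play B P n)))"
proof -
  \<comment> \<open>This bound is the \<open>N\<close> needed to turn forcing into a
    strategy.\<close>
  have "length h \<le> 6 * k - 2" if "level k h" for h :: "'v history"
    using that by (auto simp: level_def)
  then obtain B where B: "builder_strategy V B" "\<And>P. \<exists>n. level k (play B P n)"
    using forces_imp_strategy[OF assms(1) forces_level[OF assms]] by metis
  show ?thesis
  proof (intro exI conjI allI)
    show "builder_strategy V B" by (rule B(1))
  next
    fix P
    obtain n where "level k (play B P n)" using B(2) by blast
    then show "(\<exists>n \<le> 6 * k - 2. contains_mono_path Red 3 (play B P n)
                          \<or> contains_mono_path Blue 3 (play B P n))
       \<or> (\<exists>n \<le> 6 * k - 3. contains_bad_green_path (4 * k - 1) (play B P n))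
       \<or> (\<exists>n \<le> 6 * k - 2. contains_good_green_path (4 * k - 1) (play B P n))"
      unfolding level_def length_play by blast
  qed
qed

end
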